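(* Let $M$ be a matroid. If $M$ contains two disjoint bases, then $$T_M(0,2a)\ \ge\ T_M(a,a)\qquad\text{for all real } a\ge 2.$$ Dually, if the ground set of $M$ is the union of two bases of $M$, then $$T_M(2a,0)\ \ge\ T_M(a,a)\qquad\text{for all real } a\ge 2.$$
   Context: Matroids are finite. For a matroid $M=(E,r)$ with rank function $r$, the Tutte polynomial is $T_M(x,y)=\sum_{A\subseteq E}(x-1)^{r(E)-r(A)}(y-1)^{|A|-r(A)}$. *)

theory Defs
  imports Complex_Main
begin

text \<open>
  A finite matroid \<open>M = (E, r)\<close> given by its ground set and its rank function. Only the values
  of \<open>r\<close> on subsets of \<open>E\<close> matter; \<open>r\<close> is unconstrained elsewhere.
\<close>

locale matroid =
  fixes E :: "'a set" and r :: "'a set \<Rightarrow> nat"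
  assumes finite_ground: "finite E"
    and rank_le_card: "A \<subseteq> E \<Longrightarrow> r A \<le> card A"
    and rank_mono: "A \<subseteq> B \<Longrightarrow> B \<subseteq> E \<Longrightarrow> r A \<le> r B"
    and rank_submodular:
      "A \<subseteq> E \<Longrightarrow> B \<subseteq> E \<Longrightarrow> r (A \<union> B) + r (A \<inter> B) \<le> r A + r B"

definition matroid_indep :: "'a set \<Rightarrow> ('a set \<Rightarrow> nat) \<Rightarrow> 'a set \<Rightarrow> bool" where
  "matroid_indep E r A \<longleftrightarrow> A \<subseteq> E \<and> r A = card A"

definition matroid_basis :: "'a set \<Rightarrow> ('a set \<Rightarrow> nat) \<Rightarrow> 'a set \<Rightarrow> bool" where
  "matroid_basis E r B \<longleftrightarrow>
     matroid_indep E r B \<and> (\<forall>A. matroid_indep E r A \<longrightarrow> B \<subseteq> A \<longrightarrow> A = B)"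

text \<open>
  For a matroid, \<open>r A \<le> r E\<close> and \<open>r A \<le> card A\<close> for every \<open>A \<subseteq> E\<close>, so neither of the two
  subtractions of natural numbers in the exponents truncates. Note that \<open>0 ^ 0 = 1\<close>, which is
  the convention needed when \<open>x = 1\<close> or \<open>y = 1\<close>.
\<close>

definition tutte :: "'a set \<Rightarrow> ('a set \<Rightarrow> nat) \<Rightarrow> real \<Rightarrow> real \<Rightarrow> real" where
  "tutte E r x y = (\<Sum>A\<in>Pow E. (x - 1) ^ (r E - r A) * (y - 1) ^ (card A - r A))"

end

theory Submission
  imports Defs
begin

text \<open>
  Both sides are compared with \<open>(2 * a) ^ (card E - r E)\<close>. Deletion and contraction show that
  \<open>tutte E r 0 y \<ge> y ^ (card E - r E)\<close> for a matroid without coloops and \<open>y \<ge> 0\<close>.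
  On the diagonal, the weight of \<open>A\<close> is \<open>(a - 1)\<close> to the power corank plus nullity, an exponent
  that changes by exactly one when an element is added. If \<open>E\<close> is the disjoint union of two
  bases, symmetric exchange provides \<open>e\<close> in one and \<open>f\<close> in the other such that contracting
  either one of \<open>e\<close>, \<open>f\<close> and deleting the other gives again a disjoint union of two
  bases. The subsets containing exactly one of \<open>e\<close>, \<open>f\<close> are thus handled by induction, and each
  of the others is compared with one of these at the cost of a factor \<open>a - 1 \<ge> 1\<close>.
  An element outside both bases costs at most a factor \<open>1 + (a - 1) = a\<close>.
  The second inequality is the first one for the dual matroid.
\<close>

text \<open>Subtracting \<open>r {e}\<close> instead of 1 covers loops as well: contracting a loop
  then agrees with deleting it.\<close>

definition contract_rank :: "('a set \<Rightarrow> nat) \<Rightarrow> 'a \<Rightarrow> 'a set \<Rightarrow> nat" where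
  "contract_rank r e A = r (insert e A) - r {e}"

text \<open>The ground set is a parameter because complements are taken in it. On subsets of
  \<open>E\<close> the subtraction does not truncate, by \<open>rank_ground_le\<close>.\<close>

definition dual_rank :: "'a set \<Rightarrow> ('a set \<Rightarrow> nat) \<Rightarrow> 'a set \<Rightarrow> nat" where
  "dual_rank E r A = card A + r (E - A) - r E"

section \<open>Rank inequalities, bases and exchange\<close>

context matroid
begin

lemma finite_sub: "A \<subseteq> E \<Longrightarrow> finite A"
  using finite_ground finite_subset by blast

lemma rank_empty: "r {} = 0"
  using rank_le_card[of "{}"] by simp

lemma rank_Un_le: "A \<subseteq> E \<Longrightarrow> B \<subseteq> E \<Longrightarrow> r (A \<union> B) \<le> r A + r B"
  using rank_submodular[of A B] by linarith

lemma rank_insert_le: "A \<subseteq> E \<Longrightarrow> e \<in> E \<Longrightarrow> r (insert e A) \<le> r A + r {e}"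
  using rank_Un_le[of A "{e}"] by simp

lemma rank_singleton_le: "e \<in> E \<Longrightarrow> r {e} \<le> 1"
  using rank_le_card[of "{e}"] by simp

lemma rank_insert_le_Suc: "A \<subseteq> E \<Longrightarrow> e \<in> E \<Longrightarrow> r (insert e A) \<le> Suc (r A)"
  using rank_insert_le[of A e] rank_singleton_le[of e] by linarith

lemma rank_insert_ge: "A \<subseteq> E \<Longrightarrow> e \<in> E \<Longrightarrow> r A \<le> r (insert e A)"
  using rank_mono[of A "insert e A"] by auto

lemma rank_singleton_insert_le: "A \<subseteq> E \<Longrightarrow> e \<in> E \<Longrightarrow> r {e} \<le> r (insert e A)"
  using rank_mono[of "{e}" "insert e A"] by auto

text \<open>This replaces a closure operator. Elements of \<open>X\<close> are added one at a time
  by submodularity for \<open>A \<union> X\<close> and \<open>insert x A\<close>, whose intersection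
  contains \<open>A\<close>.\<close>

lemma rank_Un_spanned:
  assumes "A \<subseteq> E" "X \<subseteq> E" "\<And>x. x \<in> X \<Longrightarrow> r (insert x A) = r A"
  shows "r (A \<union> X) = r A"
proof -
  have "finite X" using assms(2) by (rule finite_sub)
  then show ?thesis using assms(2,3)
  proof (induction X rule: finite_induct)
    case empty
    then show ?case by simp
  next
    case (insert x X)
    have IH: "r (A \<union> X) = r A" using insert by auto
    have "r ((A \<union> X) \<union> insert x A) + r ((A \<union> X) \<inter> insert x A) \<le> r (A \<union> X) + r (insert x A)"
      using assms(1) insert.prems by (intro rank_submodular) auto
    moreover have "r A \<le> r ((A \<union> X) \<inter> insert x A)"
      using assms(1) insert.prems by (intro rank_mono) auto
    moreover have "r A \<le> r (A \<union> insert x X)"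
      using assms(1) insert.prems by (intro rank_mono) auto
    moreover have "(A \<union> X) \<union> insert x A = A \<union> insert x X" by auto
    moreover have "r (insert x A) = r A" using insert.prems by auto
    ultimately show ?case using IH by simp
  qed
qed

text \<open>Maximality forbids any \<open>x\<close> from raising the rank of \<open>B\<close>, so
  \<open>B\<close> spans \<open>E\<close>. Later arguments use these rank equations in place of
  maximality.\<close>

lemma basis_rank:
  assumes "matroid_basis E r B"
  shows "B \<subseteq> E" "r B = card B" "r B = r E"
proof -
  show B: "B \<subseteq> E" "r B = card B"
    using assms by (auto simp: matroid_basis_def matroid_indep_def)
  have "r (insert x B) = r B" if x: "x \<in> E" for x
  proof (rule ccontr)
    assume ne: "r (insert x B) \<noteq> r B"
    then have "x \<notin> B" by (auto simp: insert_absorb)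
    moreover have "r (insert x B) = Suc (r B)"
      using ne rank_insert_ge[OF B(1) x] rank_insert_le_Suc[OF B(1) x] by linarith
    ultimately have "matroid_indep E r (insert x B)"
      using B x finite_sub[OF B(1)] by (auto simp: matroid_indep_def)
    then have "insert x B = B"
      using assms by (auto simp: matroid_basis_def)
    then show False using \<open>x \<notin> B\<close> by auto
  qed
  then have "r (B \<union> E) = r B" using B(1) by (intro rank_Un_spanned) auto
  moreover have "B \<union> E = E" using B(1) by auto
  ultimately show "r B = r E" by simp
qed

text \<open>Subadditivity gives \<open>card B = r B \<le> r A + r (B - A) \<le> card A + card (B -
  A) = card B\<close>, so equality holds throughout.\<close>

lemma indep_subset:
  assumes "B \<subseteq> E" "r B = card B" "A \<subseteq> B"
  shows "r A = card A"
proof -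
  have fin: "finite B" using assms(1) by (rule finite_sub)
  have "r (A \<union> (B - A)) \<le> r A + r (B - A)"
    using assms by (intro rank_Un_le) auto
  moreover have "A \<union> (B - A) = B" using assms(3) by auto
  moreover have "r (B - A) \<le> card (B - A)" "r A \<le> card A"
    using assms by (auto intro!: rank_le_card)
  moreover have "card B = card A + card (B - A)"
    using assms(3) fin by (metis card_Diff_subset card_mono finite_subset le_add_diff_inverse)
  ultimately show ?thesis using assms(2) by simp
qed

text \<open>The element \<open>f\<close> is found in a minimal \<open>C \<subseteq> B2\<close> spanning \<open>e\<close>, so that \<open>insert e C\<close> is the
  fundamental circuit of \<open>e\<close>.\<close>

lemma symmetric_exchange:
  assumes B1: "B1 \<subseteq> E" "r B1 = card B1" "r B1 = r E"
    and B2: "B2 \<subseteq> E" "r B2 = card B2" "r B2 = r E"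
    and e: "e \<in> B1" "e \<notin> B2"
  shows "\<exists>f\<in>B2. r (insert f (B1 - {e})) = r E \<and> r (insert e (B2 - {f})) = r E"
proof -
  have eE: "e \<in> E" using B1 e by auto
  have fin: "finite B1" "finite B2" using B1 B2 finite_sub by auto
  \<comment> \<open>A subset \<open>C\<close> of \<open>B2\<close> has rank \<open>card C\<close>,
    so the equation says that \<open>C\<close> spans \<open>e\<close>.\<close>
  let ?P = "\<lambda>C. C \<subseteq> B2 \<and> r (insert e C) = card C"
  have "r (insert e B2) = card B2"
    using rank_insert_ge[OF B2(1) eE] rank_mono[of "insert e B2" E] B2 eE by auto
  then have "?P B2" by simp
  then obtain C where C: "?P C" and Cmin: "\<And>D. ?P D \<Longrightarrow> card C \<le> card D"
    using ex_has_least_nat[of ?P B2 card] by blast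
  have finC: "finite C" using C fin finite_subset by blast
  have CE: "C \<subseteq> E" using C B2 by auto
  have rC: "r C = card C" using indep_subset[OF B2(1,2)] C by auto
  have B1e: "r (B1 - {e}) = card B1 - 1" "card B1 \<ge> 1"
    using indep_subset[OF B1(1,2), of "B1 - {e}"] e fin
    by (auto simp: Suc_le_eq card_gt_0_iff)
  have B1eE: "B1 - {e} \<subseteq> E" using B1 by auto
  \<comment> \<open>If \<open>B1 - {e}\<close> spanned all of \<open>C\<close>, it would also span
    \<open>e\<close>, which \<open>C\<close> spans, and hence would have the rank of
    \<open>B1\<close>.\<close>
  have "\<exists>f\<in>C. r (insert f (B1 - {e})) \<noteq> r (B1 - {e})"
  proof (rule ccontr)
    assume "\<not> ?thesis"
    then have span: "r ((B1 - {e}) \<union> C) = r (B1 - {e})"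
      by (intro rank_Un_spanned[OF B1eE CE]) auto
    have "r (((B1 - {e}) \<union> C) \<union> insert e C) + r (((B1 - {e}) \<union> C) \<inter> insert e C)
        \<le> r ((B1 - {e}) \<union> C) + r (insert e C)"
      using B1eE CE eE by (intro rank_submodular) auto
    moreover have "r C \<le> r (((B1 - {e}) \<union> C) \<inter> insert e C)"
      using CE eE by (intro rank_mono) auto
    moreover have "r B1 \<le> r (((B1 - {e}) \<union> C) \<union> insert e C)"
      using B1eE CE eE by (intro rank_mono) auto
    ultimately show False using span B1e B1 C rC by simp
  qed
  then obtain f where f: "f \<in> C" "r (insert f (B1 - {e})) \<noteq> r (B1 - {e})" by auto
  have fE: "f \<in> E" "f \<in> B2" using f CE C by auto
  have "r (insert f (B1 - {e})) = r E"
    using rank_insert_ge[OF B1eE fE(1)] rank_insert_le_Suc[OF B1eE fE(1)] f(2) B1e B1 by simp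
  moreover have "r (insert e (B2 - {f})) = r E"
  proof (rule ccontr)
    assume ne: "r (insert e (B2 - {f})) \<noteq> r E"
    have sub: "insert e (B2 - {f}) \<subseteq> E" using B2 eE by auto
    have lt: "r (insert e (B2 - {f})) < card B2"
      using rank_mono[OF sub] ne B2 by auto
    \<comment> \<open>The union contains \<open>B2\<close> and the intersection is
      \<open>insert e (C - {f})\<close>. A rank deficiency of \<open>insert e (B2 - {f})\<close>
      thus passes to the intersection, so the smaller set \<open>C - {f}\<close> spans
      \<open>e\<close>, against minimality.\<close>
    have "r (insert e (B2 - {f}) \<union> insert e C) + r (insert e (B2 - {f}) \<inter> insert e C)
        \<le> r (insert e (B2 - {f})) + r (insert e C)"
      using sub CE eE by (intro rank_submodular) auto
    moreover have "r B2 \<le> r (insert e (B2 - {f}) \<union> insert e C)"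
      using sub CE eE f by (intro rank_mono) auto
    moreover have "insert e (B2 - {f}) \<inter> insert e C = insert e (C - {f})"
      using C by auto
    ultimately have "r (insert e (C - {f})) < card C"
      using lt C B2 by simp
    moreover have "r (C - {f}) = card C - 1"
      using indep_subset[OF CE rC, of "C - {f}"] f finC by auto
    moreover have "r (C - {f}) \<le> r (insert e (C - {f}))"
      using CE eE by (intro rank_insert_ge) auto
    ultimately have "?P (C - {f})" using C f finC by auto
    from Cmin[OF this] show False
      using f finC card_Diff1_less[of C f] by simp
  qed
  ultimately show ?thesis using fE by blast
qed

section \<open>Deletion, contraction and duality\<close>

lemma matroid_delete: "F \<subseteq> E \<Longrightarrow> matroid F r"
  by unfold_locales (auto simp: finite_sub rank_le_card rank_mono rank_submodular)

lemma matroid_contract: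
  assumes e: "e \<in> E" and F: "F \<subseteq> E"
  shows "matroid F (contract_rank r e)"
proof
  show "finite F" using F by (rule finite_sub)
next
  fix A assume "A \<subseteq> F"
  then have "A \<subseteq> E" using F by auto
  then show "contract_rank r e A \<le> card A"
    using rank_insert_le[of A e] rank_le_card[of A] e unfolding contract_rank_def by simp
next
  fix A B assume "A \<subseteq> B" "B \<subseteq> F"
  then have "r (insert e A) \<le> r (insert e B)"
    using e F by (intro rank_mono) auto
  then show "contract_rank r e A \<le> contract_rank r e B"
    unfolding contract_rank_def by (rule diff_le_mono)
next
  fix A B assume "A \<subseteq> F" "B \<subseteq> F"
  then have AB: "A \<subseteq> E" "B \<subseteq> E" "A \<union> B \<subseteq> E" "A \<inter> B \<subseteq> E" using F by auto
  have "insert e A \<union> insert e B = insert e (A \<union> B)" "insert e A \<inter> insert e B = insert e (A \<inter> B)"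
    by auto
  then have "r (insert e (A \<union> B)) + r (insert e (A \<inter> B)) \<le> r (insert e A) + r (insert e B)"
    using rank_submodular[of "insert e A" "insert e B"] AB e by simp
  \<comment> \<open>All four ranks are at least \<open>r {e}\<close>, so the subtractions do not
    truncate and the inequality carries over.\<close>
  then show "contract_rank r e (A \<union> B) + contract_rank r e (A \<inter> B)
      \<le> contract_rank r e A + contract_rank r e B"
    using AB[THEN rank_singleton_insert_le, OF e] unfolding contract_rank_def by linarith
qed

lemma rank_ground_le: "A \<subseteq> E \<Longrightarrow> r E \<le> card A + r (E - A)"
  using rank_Un_le[of "E - A" A] rank_le_card[of A] by (simp add: Un_absorb2)

text \<open>Monotonicity holds because enlarging \<open>A\<close> to \<open>B\<close> adds
  \<open>card (B - A)\<close> and lowers the rank of the complement by at most that number.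
  Submodularity is that of \<open>r\<close> on complements, since cardinality is modular.\<close>

lemma matroid_dual: "matroid E (dual_rank E r)"
proof
  show "finite E" by (rule finite_ground)
next
  fix A assume "A \<subseteq> E"
  then show "dual_rank E r A \<le> card A"
    using rank_mono[of "E - A" E] unfolding dual_rank_def by simp
next
  fix A B assume AB: "A \<subseteq> B" "B \<subseteq> E"
  have "r ((E - B) \<union> (B - A)) \<le> r (E - B) + r (B - A)"
    using AB by (intro rank_Un_le) auto
  moreover have "(E - B) \<union> (B - A) = E - A" using AB by auto
  moreover have "r (B - A) \<le> card (B - A)" using AB by (intro rank_le_card) auto
  moreover have "card (B - A) = card B - card A" "card A \<le> card B"
    using AB finite_sub by (auto intro!: card_Diff_subset card_mono intro: finite_subset)
  ultimately show "dual_rank E r A \<le> dual_rank E r B"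
    unfolding dual_rank_def by simp
next
  fix A B assume AB: "A \<subseteq> E" "B \<subseteq> E"
  have "r ((E - A) \<union> (E - B)) + r ((E - A) \<inter> (E - B)) \<le> r (E - A) + r (E - B)"
    by (intro rank_submodular) auto
  moreover have "(E - A) \<union> (E - B) = E - A \<inter> B" "(E - A) \<inter> (E - B) = E - (A \<union> B)" by auto
  moreover have "card (A \<union> B) + card (A \<inter> B) = card A + card B"
    using AB finite_sub card_Un_Int by metis
  moreover have "r E \<le> card (A \<union> B) + r (E - (A \<union> B))" "r E \<le> card (A \<inter> B) + r (E - A \<inter> B)"
    using AB by (auto intro!: rank_ground_le)
  ultimately show "dual_rank E r (A \<union> B) + dual_rank E r (A \<inter> B)
      \<le> dual_rank E r A + dual_rank E r B"
    unfolding dual_rank_def by simp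
qed

text \<open>Complementation interchanges corank in the dual with nullity in the matroid, and nullity
  with corank.\<close>

lemma tutte_dual: "tutte E (dual_rank E r) x y = tutte E r y x"
  unfolding tutte_def
proof (rule sum.reindex_bij_witness[of _ "\<lambda>A. E - A" "\<lambda>A. E - A"])
  fix A assume "A \<in> Pow E"
  then have A: "A \<subseteq> E" by simp
  have "card (E - A) + card A = card E"
    using A finite_ground by (metis card_Diff_subset card_mono finite_sub le_add_diff_inverse2)
  moreover have "r (E - A) \<le> card (E - A)" "r (E - A) \<le> r E" "r E \<le> card A + r (E - A)"
    using A by (auto intro!: rank_le_card rank_mono rank_ground_le)
  ultimately have "dual_rank E r E - dual_rank E r A = card (E - A) - r (E - A)"
    "card A - dual_rank E r A = r E - r (E - A)"
    unfolding dual_rank_def by (simp_all add: rank_empty)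
  then show "(y - 1) ^ (r E - r (E - A)) * (x - 1) ^ (card (E - A) - r (E - A)) =
      (x - 1) ^ (dual_rank E r E - dual_rank E r A) * (y - 1) ^ (card A - dual_rank E r A)"
    by simp
qed auto

end

section \<open>Deletion and contraction for the Tutte polynomial\<close>

lemma sum_Pow_insert:
  assumes "finite F" "e \<notin> F"
  shows "(\<Sum>A\<in>Pow (insert e F). g A) = (\<Sum>A\<in>Pow F. g A + (g (insert e A) :: real))"
proof -
  have "(\<Sum>A\<in>Pow (insert e F). g A) = sum g (Pow F) + sum g (insert e ` Pow F)"
    unfolding Pow_insert using assms by (intro sum.union_disjoint) auto
  also have "sum g (insert e ` Pow F) = (\<Sum>A\<in>Pow F. g (insert e A))"
    using assms by (intro sum.reindex_cong[of "insert e"]) (auto simp: inj_on_def)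
  finally show ?thesis by (simp add: sum.distrib)
qed

lemma tutte_loop:
  assumes M: "matroid (insert e F) r" and e: "e \<notin> F" and loop: "r {e} = 0"
  shows "tutte (insert e F) r x y = y * tutte F r x y"
proof -
  interpret matroid "insert e F" r by (rule M)
  have fin: "finite F" using finite_ground by simp
  have rA: "r (insert e A) = r A" if "A \<subseteq> F" for A
    using rank_insert_le[of A e] rank_insert_ge[of A e] loop that by fastforce
  \<comment> \<open>Adding the loop raises only the nullity, by one. The weights of \<open>A\<close>
    and \<open>insert e A\<close> therefore add up to \<open>1 + (y - 1)\<close> times the weight of
    \<open>A\<close> in \<open>F\<close>.\<close>
  have "(x - 1) ^ (r (insert e F) - r (insert e A)) * (y - 1) ^ (card (insert e A) - r (insert e A))
      = (y - 1) * ((x - 1) ^ (r F - r A) * (y - 1) ^ (card A - r A))" if A: "A \<subseteq> F" for A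
  proof -
    have "card (insert e A) = Suc (card A)"
      using A e fin finite_subset by (metis card_insert_disjoint subsetD)
    moreover have "r A \<le> card A" using A by (intro rank_le_card) auto
    ultimately show ?thesis using rA[OF A] rA[of F] by (simp add: Suc_diff_le)
  qed
  then show ?thesis
    unfolding tutte_def sum_Pow_insert[OF fin e] sum_distrib_left using rA[of F]
    by (intro sum.cong) (auto simp: algebra_simps)
qed

lemma tutte_coloop:
  assumes M: "matroid (insert e F) r" and e: "e \<notin> F" and coloop: "r F \<noteq> r (insert e F)"
  shows "tutte (insert e F) r x y = x * tutte F r x y"
proof -
  interpret matroid "insert e F" r by (rule M)
  have fin: "finite F" using finite_ground by simp
  have rF: "r (insert e F) = Suc (r F)"
    using rank_insert_ge[of F e] rank_insert_le_Suc[of F e] coloop by fastforce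
  have rA: "r (insert e A) = Suc (r A)" if "A \<subseteq> F" for A
  proof -
    \<comment> \<open>The union is the whole ground set and the intersection is \<open>A\<close>, so
      the jump of rank at \<open>F\<close> forces a jump at every \<open>A\<close>.\<close>
    have "r (F \<union> insert e A) + r (F \<inter> insert e A) \<le> r F + r (insert e A)"
      using that by (intro rank_submodular) auto
    moreover have "F \<union> insert e A = insert e F" "F \<inter> insert e A = A" using that e by auto
    moreover have "r (insert e A) \<le> Suc (r A)" using that by (intro rank_insert_le_Suc) auto
    ultimately show ?thesis using rF by simp
  qed
  \<comment> \<open>Without \<open>e\<close> the corank is one more than in \<open>F\<close>; with
    \<open>e\<close> both exponents are as in \<open>F\<close>. The two weights give the factor
    \<open>(x - 1) + 1\<close>.\<close>
  have "(x - 1) ^ (r (insert e F) - r A) * (y - 1) ^ (card A - r A)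
      = (x - 1) * ((x - 1) ^ (r F - r A) * (y - 1) ^ (card A - r A))" if A: "A \<subseteq> F" for A
  proof -
    have "r A \<le> r F" using A by (intro rank_mono) auto
    then show ?thesis using rF by (simp add: Suc_diff_le)
  qed
  moreover have "(x - 1) ^ (r (insert e F) - r (insert e A)) *
        (y - 1) ^ (card (insert e A) - r (insert e A))
      = (x - 1) ^ (r F - r A) * (y - 1) ^ (card A - r A)" if A: "A \<subseteq> F" for A
  proof -
    have "card (insert e A) = Suc (card A)"
      using A e fin finite_subset by (metis card_insert_disjoint subsetD)
    then show ?thesis using rA[OF A] rA[of F] by simp
  qed
  ultimately show ?thesis
    unfolding tutte_def sum_Pow_insert[OF fin e] sum_distrib_left
    by (intro sum.cong) (auto simp: algebra_simps)
qed

text \<open>The contraction collects the terms of the sets containing \<open>e\<close>. Here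
  \<open>F\<close> may be smaller than \<open>E - {e}\<close>, so that the exchange argument can
  also delete \<open>f\<close>; the spanning condition keeps the coranks equal.\<close>

lemma tutte_contract:
  assumes M: "matroid E r" and F: "F \<subseteq> E" and e: "e \<in> E" "e \<notin> F" and nonloop: "r {e} \<noteq> 0"
    and span: "r (insert e F) = r E"
  shows "tutte F (contract_rank r e) x y =
    (\<Sum>A\<in>Pow F. (x - 1) ^ (r E - r (insert e A)) *
      (y - 1) ^ (card (insert e A) - r (insert e A)))"
  unfolding tutte_def
proof (intro sum.cong refl)
  interpret matroid E r by (rule M)
  have re: "r {e} = 1" using rank_singleton_le[OF e(1)] nonloop by simp
  fix A assume "A \<in> Pow F"
  then have A: "A \<subseteq> F" by simp
  then have AE: "A \<subseteq> E" using F by auto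
  have "r {e} \<le> r (insert e A)" "r {e} \<le> r (insert e F)"
    using rank_singleton_insert_le e(1) AE F by auto
  moreover have "card (insert e A) = Suc (card A)"
    using A e finite_sub[OF AE] by (metis card_insert_disjoint subsetD)
  ultimately have "contract_rank r e F - contract_rank r e A = r E - r (insert e A)"
    "card A - contract_rank r e A = card (insert e A) - r (insert e A)"
    unfolding contract_rank_def using re span by simp_all
  then show "(x - 1) ^ (contract_rank r e F - contract_rank r e A) *
      (y - 1) ^ (card A - contract_rank r e A) =
      (x - 1) ^ (r E - r (insert e A)) * (y - 1) ^ (card (insert e A) - r (insert e A))"
    by simp
qed

lemma tutte_delete_contract:
  assumes M: "matroid (insert e F) r" and e: "e \<notin> F"
    and "r {e} \<noteq> 0" and "r F = r (insert e F)"
  shows "tutte (insert e F) r x y = tutte F r x y + tutte F (contract_rank r e) x y"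
proof -
  interpret matroid "insert e F" r by (rule M)
  have fin: "finite F" using finite_ground by simp
  have "tutte F (contract_rank r e) x y =
    (\<Sum>A\<in>Pow F. (x - 1) ^ (r (insert e F) - r (insert e A)) *
      (y - 1) ^ (card (insert e A) - r (insert e A)))"
    using assms by (intro tutte_contract) auto
  then show ?thesis
    using assms(4) unfolding tutte_def sum_Pow_insert[OF fin e] by (simp add: sum.distrib)
qed

section \<open>Lower bound at x = 0\<close>

lemma tutte_nonneg:
  assumes "matroid E r" "x \<ge> 0" "y \<ge> 0"
  shows "tutte E r x y \<ge> 0"
proof -
  have "finite E" using assms(1) by (rule matroid.finite_ground)
  then show ?thesis using assms(1)
  proof (induction E arbitrary: r rule: finite_induct)
    case empty
    then show ?case by (simp add: tutte_def)
  next
    case (insert e F)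
    interpret matroid "insert e F" r by (rule insert.prems)
    have "tutte F r x y \<ge> 0" "tutte F (contract_rank r e) x y \<ge> 0"
      using insert.IH matroid_delete[of F] matroid_contract[of e F] by auto
    then show ?case
      using tutte_loop[OF insert.prems] tutte_coloop[OF insert.prems]
        tutte_delete_contract[OF insert.prems] insert.hyps assms(2,3)
      by (cases "r {e} = 0"; cases "r F = r (insert e F)") simp_all
  qed
qed

text \<open>A loop yields the factor \<open>y\<close> and one unit of nullity. For a nonloop,
  contraction alone suffices: it lowers cardinality and rank by one each, so the nullity is
  kept.\<close>

lemma tutte_zero_ge_power:
  assumes "matroid E r" "\<And>g. g \<in> E \<Longrightarrow> r (E - {g}) = r E" "y \<ge> 0"
  shows "tutte E r 0 y \<ge> y ^ (card E - r E)"
proof -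
  have "finite E" using assms(1) by (rule matroid.finite_ground)
  then show ?thesis using assms(1,2)
  proof (induction E arbitrary: r rule: finite_induct)
    case empty
    interpret matroid "{}" r by (rule empty.prems(1))
    show ?case by (simp add: tutte_def rank_empty)
  next
    case (insert e F)
    interpret matroid "insert e F" r by (rule insert.prems(1))
    have diff: "insert e F - {g} = insert e (F - {g})" "g \<noteq> e" if "g \<in> F" for g
      using that insert.hyps by auto
    have rF: "r F = r (insert e F)"
      using insert.prems(2)[of e] insert.hyps by simp
    have card: "card (insert e F) = Suc (card F)" using insert.hyps by simp
    show ?case
    proof (cases "r {e} = 0")
      case True
      have rA: "r (insert e A) = r A" if "A \<subseteq> F" for A
        using rank_insert_le[of A e] rank_insert_ge[of A e] True that by fastforce
      have "tutte F r 0 y \<ge> y ^ (card F - r F)"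
      proof (rule insert.IH)
        show "matroid F r" by (rule matroid_delete) auto
        show "r (F - {g}) = r F" if "g \<in> F" for g
          using insert.prems(2)[of g] diff[OF that] rA[of "F - {g}"] rF that by auto
      qed
      moreover have "r F \<le> card F" by (rule rank_le_card) auto
      ultimately show ?thesis
        using tutte_loop[OF insert.prems(1) insert.hyps(2) True, of 0 y] rF card assms(3)
        by (simp add: Suc_diff_le mult_left_mono)
    next
      case False
      have "tutte F (contract_rank r e) 0 y \<ge> y ^ (card F - contract_rank r e F)"
      proof (rule insert.IH)
        show "matroid F (contract_rank r e)" by (rule matroid_contract) auto
        \<comment> \<open>Contraction creates no coloops: \<open>insert e (F - {g})\<close> is the
          ground set without \<open>g\<close>, which has full rank by hypothesis.\<close>
        show "contract_rank r e (F - {g}) = contract_rank r e F" if "g \<in> F" for g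
          using insert.prems(2)[of g] diff[OF that] that by (simp add: contract_rank_def)
      qed
      moreover have "tutte F r 0 y \<ge> 0"
        using matroid_delete[of F] assms(3) by (intro tutte_nonneg) auto
      moreover have "card F - contract_rank r e F = card (insert e F) - r (insert e F)"
        using rank_singleton_le[of e] rank_singleton_insert_le[OF subset_insertI insertI1] False card
        unfolding contract_rank_def by simp
      ultimately show ?thesis
        using tutte_delete_contract[OF insert.prems(1) insert.hyps(2) False rF, of 0 y] by simp
    qed
  qed
qed

section \<open>Upper bound on the diagonal\<close>

text \<open>A new element either raises the rank, so that the corank drops by one, or leaves it, so
  that the nullity grows by one. The other exponent is unchanged in both cases.\<close>

lemma diagonal_weight_step:
  fixes s :: real
  assumes M: "matroid E r" and A: "A \<subseteq> E" and e: "e \<in> E" "e \<notin> A" and s: "s \<ge> 1"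
  defines "w \<equiv> \<lambda>A. s ^ (r E - r A) * s ^ (card A - r A)"
  shows "w A \<le> s * w (insert e A)" "w (insert e A) \<le> s * w A"
proof -
  interpret matroid E r by (rule M)
  have w: "w B = s ^ ((r E - r B) + (card B - r B))" for B
    unfolding w_def by (simp add: power_add)
  have "insert e A \<subseteq> E" using A e by auto
  then have "r (insert e A) \<le> r E" "r (insert e A) \<le> card (insert e A)" "r A \<le> card A"
    using A rank_mono rank_le_card by auto
  moreover have "r A \<le> r (insert e A)" "r (insert e A) \<le> Suc (r A)"
    using rank_insert_ge rank_insert_le_Suc A e by auto
  moreover have "card (insert e A) = Suc (card A)"
    using e finite_sub[OF A] by simp
  ultimately have
    "(r E - r A) + (card A - r A) \<le> Suc ((r E - r (insert e A)) + (card (insert e A) - r (insert e A)))"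
    "(r E - r (insert e A)) + (card (insert e A) - r (insert e A)) \<le> Suc ((r E - r A) + (card A - r A))"
    by linarith+
  then show "w A \<le> s * w (insert e A)" "w (insert e A) \<le> s * w A"
    unfolding w power_Suc[symmetric] using s by (auto intro: power_increasing simp del: power_Suc)
qed

lemma tutte_diagonal_insert_le:
  assumes M: "matroid (insert e F) r" and e: "e \<notin> F" and rF: "r (insert e F) = r F"
    and a: "a \<ge> 2"
  shows "tutte (insert e F) r a a \<le> a * tutte F r a a"
proof -
  interpret matroid "insert e F" r by (rule M)
  have fin: "finite F" using finite_ground by simp
  define w where "w A = (a - 1) ^ (r (insert e F) - r A) * (a - 1) ^ (card A - r A)" for A
  have "w (insert e A) \<le> (a - 1) * w A" if "A \<in> Pow F" for A
    unfolding w_def using that e a by (intro diagonal_weight_step(2)[OF M]) auto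
  then have "(\<Sum>A\<in>Pow F. w A + w (insert e A)) \<le> (\<Sum>A\<in>Pow F. a * w A)"
    by (intro sum_mono) (fastforce simp: algebra_simps)
  then show ?thesis
    unfolding tutte_def sum_Pow_insert[OF fin e]
    unfolding w_def sum_distrib_left rF .
qed

text \<open>For each \<open>A \<subseteq> F\<close>, the weight of \<open>A\<close> is charged to
  \<open>insert e A\<close> and that of \<open>insert e (insert f A)\<close> to
  \<open>insert f A\<close>, which turns each coefficient into \<open>1 + (a - 1)\<close>.\<close>

lemma tutte_diagonal_exchange_le:
  assumes M: "matroid (insert e (insert f F)) r" and ef: "e \<noteq> f" "e \<notin> F" "f \<notin> F"
    and e: "r {e} \<noteq> 0" "r (insert e F) = r (insert e (insert f F))"
    and f: "r {f} \<noteq> 0" "r (insert f F) = r (insert e (insert f F))"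
    and a: "a \<ge> 2"
  shows "tutte (insert e (insert f F)) r a a
    \<le> a * (tutte F (contract_rank r e) a a + tutte F (contract_rank r f) a a)"
proof -
  let ?E = "insert e (insert f F)"
  interpret matroid ?E r by (rule M)
  have fin: "finite F" using finite_ground by simp
  define w where "w A = (a - 1) ^ (r ?E - r A) * (a - 1) ^ (card A - r A)" for A
  have "tutte ?E r a a = (\<Sum>A\<in>Pow F. (w A + w (insert f A)) + (w (insert e A) + w (insert e (insert f A))))"
    unfolding tutte_def w_def[symmetric] using ef fin
    by (simp add: sum_Pow_insert sum.distrib)
  also have "\<dots> \<le> (\<Sum>A\<in>Pow F. a * (w (insert e A) + w (insert f A)))"
  proof (rule sum_mono)
    fix A assume A: "A \<in> Pow F"
    have "w A \<le> (a - 1) * w (insert e A)"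
      unfolding w_def using A ef a by (intro diagonal_weight_step(1)[OF M]) auto
    moreover have "w (insert e (insert f A)) \<le> (a - 1) * w (insert f A)"
      unfolding w_def using A ef a by (intro diagonal_weight_step(2)[OF M]) auto
    ultimately show "(w A + w (insert f A)) + (w (insert e A) + w (insert e (insert f A)))
        \<le> a * (w (insert e A) + w (insert f A))"
      by (simp add: algebra_simps)
  qed
  also have "\<dots> = a * ((\<Sum>A\<in>Pow F. w (insert e A)) + (\<Sum>A\<in>Pow F. w (insert f A)))"
    by (simp only: sum.distrib flip: sum_distrib_left)
  also have "(\<Sum>A\<in>Pow F. w (insert e A)) = tutte F (contract_rank r e) a a"
    unfolding w_def using ef e by (intro tutte_contract[OF M, symmetric]) auto
  also have "(\<Sum>A\<in>Pow F. w (insert f A)) = tutte F (contract_rank r f) a a"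
    unfolding w_def using ef f by (intro tutte_contract[OF M, symmetric]) auto
  finally show ?thesis .
qed

text \<open>Each step lowers the nullity by one at a cost of at most \<open>2 * a\<close>. The
  induction is strong because an exchange removes two elements.\<close>

lemma tutte_diagonal_le:
  assumes "matroid E r" "a \<ge> 2"
    "B1 \<subseteq> E" "r B1 = card B1" "r B1 = r E" "B2 \<subseteq> E" "r B2 = card B2" "r B2 = r E" "B1 \<inter> B2 = {}"
  shows "tutte E r a a \<le> (2 * a) ^ (card E - r E)"
  using assms
proof (induction "card E" arbitrary: E r B1 B2 rule: less_induct)
  case less
  interpret matroid E r by (rule less.prems(1))
  note B1 = less.prems(3-5) and B2 = less.prems(6-8) and disj = less.prems(9)
  have a: "a \<ge> 2" by (rule less.prems(2))
  have fin: "finite E" "finite B1" "finite B2" using finite_ground B1 B2 finite_sub by auto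
  consider (extra) e where "e \<in> E" "e \<notin> B1" "e \<notin> B2"
    | (empty) "E = {}" | (exch) e where "e \<in> B1" "E = B1 \<union> B2"
  proof (cases "E = B1 \<union> B2")
    case True
    \<comment> \<open>Both bases have \<open>r E\<close> elements, so an empty \<open>B1\<close>
      forces an empty \<open>B2\<close>.\<close>
    have "B1 \<noteq> {} \<or> E = {}" using True B1 B2 fin by auto
    then show ?thesis using True that by blast
  next
    case False
    then show ?thesis using that B1 B2 by blast
  qed
  then show ?case
  proof cases
    case extra
    define F where "F = E - {e}"
    have F: "E = insert e F" "e \<notin> F" "B1 \<subseteq> F" "B2 \<subseteq> F" using extra B1 B2 by (auto simp: F_def)
    have "F \<subseteq> E" by (auto simp: F_def)
    then have "r F = r E" using rank_mono[OF F(3)] rank_mono[of F E] B1 by simp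
    have card: "card E = Suc (card F)" using F fin by simp
    have "tutte F r a a \<le> (2 * a) ^ (card F - r F)"
      using matroid_delete[of F] F B1 B2 disj a \<open>r F = r E\<close> card
      by (intro less.hyps[of F r B1 B2]) auto
    moreover have "tutte E r a a \<le> a * tutte F r a a"
      using tutte_diagonal_insert_le[of e F r a] less.prems(1) a F \<open>r F = r E\<close> by simp
    ultimately have "tutte E r a a \<le> a * (2 * a) ^ (card F - r F)"
      using a by (meson mult_left_mono order_trans zero_le_numeral)
    also have "\<dots> \<le> (2 * a) ^ Suc (card F - r F)" using a by simp
    also have "Suc (card F - r F) = card E - r E"
      using card \<open>r F = r E\<close> rank_le_card[OF \<open>F \<subseteq> E\<close>] by linarith
    finally show ?thesis .
  next
    case empty
    then show ?thesis by (simp add: tutte_def rank_empty)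
  next
    case exch
    have "e \<notin> B2" using exch disj by auto
    then obtain f where f: "f \<in> B2" "r (insert f (B1 - {e})) = r E" "r (insert e (B2 - {f})) = r E"
      using symmetric_exchange[OF B1 B2 exch(1)] by blast
    define F where "F = E - {e, f}"
    have ef: "e \<noteq> f" "e \<notin> F" "f \<notin> F" and E: "E = insert e (insert f F)"
      using exch f disj by (auto simp: F_def)
    have sub: "B1 - {e} \<subseteq> F" "B2 - {f} \<subseteq> F"
      using B1 B2 exch f disj by (auto simp: F_def)
    have FE: "F \<subseteq> E" "e \<in> E" "f \<in> E" using E by auto
    have nonloop: "r {e} = 1" "r {f} = 1"
      using indep_subset[OF B1(1,2), of "{e}"] indep_subset[OF B2(1,2), of "{f}"] exch f by auto
    have span: "r (insert e F) = r E" "r (insert f F) = r E"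
      using rank_mono[OF insert_mono[OF sub(2)], of e] rank_mono[of "insert e F" E]
        rank_mono[OF insert_mono[OF sub(1)], of f] rank_mono[of "insert f F" E] f FE by auto
    have card: "card E = Suc (Suc (card F))" using E ef fin by simp
    have cardB: "card (B1 - {e}) = r E - 1" "card (B2 - {f}) = r E - 1"
      using B1 B2 exch f by auto
    have ins: "insert e (B1 - {e}) = B1" "insert f (B2 - {f}) = B2" using exch f by auto
    \<comment> \<open>Contracting \<open>e\<close> turns \<open>B1 - {e}\<close> into a basis
      because \<open>B1\<close> is one, and \<open>B2 - {f}\<close> by the exchange property.
      Contracting \<open>f\<close> reverses the roles.\<close>
    have cr: "contract_rank r e F = r E - 1" "contract_rank r e (B1 - {e}) = r E - 1"
      "contract_rank r e (B2 - {f}) = r E - 1" "contract_rank r f F = r E - 1"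
      "contract_rank r f (B1 - {e}) = r E - 1" "contract_rank r f (B2 - {f}) = r E - 1"
      using span nonloop f B1 B2 ins unfolding contract_rank_def by auto
    have disj': "(B1 - {e}) \<inter> (B2 - {f}) = {}" using disj by auto
    have "tutte F (contract_rank r e) a a \<le> (2 * a) ^ (card F - contract_rank r e F)"
      "tutte F (contract_rank r f) a a \<le> (2 * a) ^ (card F - contract_rank r f F)"
      using FE sub cr cardB disj' a card
      by (intro less.hyps[of F _ "B1 - {e}" "B2 - {f}"] matroid_contract; simp)+
    moreover have "tutte E r a a
        \<le> a * (tutte F (contract_rank r e) a a + tutte F (contract_rank r f) a a)"
      using less.prems(1) ef nonloop span a unfolding E
      by (intro tutte_diagonal_exchange_le) auto
    ultimately have "tutte E r a a \<le> a * ((2 * a) ^ (card F - (r E - 1)) + (2 * a) ^ (card F - (r E - 1)))"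
      using a cr by (smt (verit) mult_left_mono)
    also have "\<dots> = (2 * a) ^ Suc (card F - (r E - 1))" by simp
    \<comment> \<open>Two elements are lost but only one unit of rank, so the nullity drops by
      exactly one.\<close>
    also have "Suc (card F - (r E - 1)) = card E - r E"
    proof -
      have "r E \<ge> 1" using rank_mono[of "{e}" E] nonloop FE by auto
      moreover have "r E - 1 \<le> card F"
        using sub cardB fin FE by (metis card_mono finite_sub)
      ultimately show ?thesis using card by auto
    qed
    finally show ?thesis .
  qed
qed

section \<open>Comparison of the two bounds and dualization\<close>

lemma tutte_zero_ge_diagonal:
  assumes M: "matroid E r" and a: "a \<ge> 2"
    and B: "B1 \<subseteq> E" "r B1 = card B1" "r B1 = r E" "B2 \<subseteq> E" "r B2 = card B2" "r B2 = r E"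
      "B1 \<inter> B2 = {}"
  shows "tutte E r a a \<le> tutte E r 0 (2 * a)"
proof -
  interpret matroid E r by (rule M)
  have "r (E - {g}) = r E" if "g \<in> E" for g
  proof -
    \<comment> \<open>Any \<open>g\<close> avoids one of two disjoint bases, so there are no
      coloops.\<close>
    have "B1 \<subseteq> E - {g} \<or> B2 \<subseteq> E - {g}" using B by auto
    then have "r E \<le> r (E - {g})" using rank_mono[of _ "E - {g}"] B by (metis Diff_subset)
    moreover have "r (E - {g}) \<le> r E" by (intro rank_mono) auto
    ultimately show ?thesis by simp
  qed
  then have "(2 * a) ^ (card E - r E) \<le> tutte E r 0 (2 * a)"
    using a by (intro tutte_zero_ge_power[OF M]) auto
  then show ?thesis using tutte_diagonal_le[OF M a B] by linarith
qed

theorem theorem3p3: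
  fixes E :: "'a set" and r :: "'a set \<Rightarrow> nat"
  assumes "matroid E r"
  shows "((\<exists>B1 B2. matroid_basis E r B1 \<and> matroid_basis E r B2 \<and> B1 \<inter> B2 = {})
            \<longrightarrow> (\<forall>a::real. a \<ge> 2 \<longrightarrow> tutte E r 0 (2 * a) \<ge> tutte E r a a))
       \<and> ((\<exists>B1 B2. matroid_basis E r B1 \<and> matroid_basis E r B2 \<and> B1 \<union> B2 = E)
            \<longrightarrow> (\<forall>a::real. a \<ge> 2 \<longrightarrow> tutte E r (2 * a) 0 \<ge> tutte E r a a))"
proof (intro conjI impI allI; elim exE conjE)
  interpret matroid E r by (rule assms)
  fix a :: real and B1 B2 assume a: "a \<ge> 2"
  assume B: "matroid_basis E r B1" "matroid_basis E r B2"
  {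
    assume "B1 \<inter> B2 = {}"
    then show "tutte E r 0 (2 * a) \<ge> tutte E r a a"
      by (intro tutte_zero_ge_diagonal[OF assms a basis_rank[OF B(1)] basis_rank[OF B(2)]])
  next
    assume un: "B1 \<union> B2 = E"
    \<comment> \<open>Complements of bases are bases of the dual, and they are disjoint because
      \<open>B1\<close> and \<open>B2\<close> cover \<open>E\<close>.\<close>
    have dual: "dual_rank E r (E - B) = card (E - B)" "dual_rank E r (E - B) = dual_rank E r E"
      if "matroid_basis E r B" for B
    proof -
      note * = basis_rank[OF that]
      have "E - (E - B) = B" using * by auto
      then show "dual_rank E r (E - B) = card (E - B)" using * by (simp add: dual_rank_def)
      moreover have "card (E - B) = card E - card B"
        using * finite_sub by (intro card_Diff_subset) auto
      ultimately show "dual_rank E r (E - B) = dual_rank E r E"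
        using * by (simp add: dual_rank_def rank_empty)
    qed
    have "tutte E (dual_rank E r) a a \<le> tutte E (dual_rank E r) 0 (2 * a)"
      using un by (intro tutte_zero_ge_diagonal[OF matroid_dual a _ dual[OF B(1)] _ dual[OF B(2)]]) auto
    then show "tutte E r (2 * a) 0 \<ge> tutte E r a a"
      by (simp add: tutte_dual)
  }
qed

end
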